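(* Let $n\ge2$. If $A=[a_{ij}]\in M_n$ is a strictly diagonally dominant nonsingular $M$-matrix, then for every $t=1,2,\ldots$, $$\tau(A)\geq \frac{2}{\max\limits_{i\neq j}\Big\{\phi_i^{(t)}+\phi_j^{(t)}+\Big[(\phi_{ij}^{(t)})^2+4\phi_{i}^{(t)}\phi_{j}^{(t)}\Big(\sum\limits_{k\neq i}p_{ki}^{(t)}\Big)\Big(\sum\limits_{k\neq j}p_{kj}^{(t)}\Big)\Big]^{\frac12}\Big\}},$$ where $$\phi_{ij}^{(t)}=\max\{\phi_i^{(t)},\phi_j^{(t)}\}-\min\left\{\frac{1}{a_{ii}-\sum\limits_{k\neq i}\frac{a_{ik}a_{ki}}{a_{kk}}},\ \frac{1}{a_{jj}-\sum\limits_{k\neq j}\frac{a_{jk}a_{kj}}{a_{kk}}}\right\}.$$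
   Context: Let $N=\{1,\ldots,n\}$, $n\ge2$. All indices range over $N$. A matrix is called nonnegative ($\ge 0$) if all its entries are nonnegative. A matrix $A=[a_{ij}]\in\mathbb{R}^{n\times n}$ is a nonsingular $M$-matrix if $a_{ij}\le 0$ for all $i\ne j$ and $A$ is invertible with $A^{-1}\ge 0$; $M_n$ denotes the set of all $n\times n$ nonsingular $M$-matrices. For $A\in M_n$, $\tau(A)=\rho(A^{-1})^{-1}$, where $\rho$ denotes the spectral radius (the minimum eigenvalue of $A$; equivalently $\tau(A)=\min\{|\lambda|:\lambda\in\sigma(A)\}$). $A$ is strictly diagonally dominant if $\sum_{j\ne i}|a_{ij}|<|a_{ii}|$ for all $i\in N$. For $A=[a_{ij}]$ with $a_{ii}\ne0$, for $i,j\in N$, $j\ne i$, and $t=1,2,\ldots$, define $$r_i=\max_{j\neq i}\frac{|a_{ji}|}{|a_{jj}|-\sum_{k\ne j,i}|a_{jk}|},\qquad m_{ji}=\frac{|a_{ji}|+\sum_{k\ne j,i}|a_{jk}|r_i}{|a_{jj}|},$$ $$h_i=\max_{j\ne i}\frac{|a_{ji}|}{|a_{jj}|m_{ji}-\sum_{k\ne j,i}|a_{jk}|m_{ki}},\qquad u_{ji}=\frac{|a_{ji}|+\sum_{k\ne j,i}|a_{jk}|m_{ki}h_i}{|a_{jj}|},\qquad u^{(0)}_{ji}=u_{ji},$$ and recursively $$p^{(t)}_{ji}=\frac{|a_{ji}|+\sum_{k\ne j,i}|a_{jk}|u^{(t-1)}_{ki}}{|a_{jj}|},\qquad h^{(t)}_i=\max_{j\ne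 i}\frac{|a_{ji}|}{|a_{jj}|p^{(t)}_{ji}-\sum_{k\ne j,i}|a_{jk}|p^{(t)}_{ki}},\qquad u^{(t)}_{ji}=\frac{|a_{ji}|+\sum_{k\ne j,i}|a_{jk}|p^{(t)}_{ki}h^{(t)}_i}{|a_{jj}|}.$$ Finally, $$\phi_i^{(t)}=\frac{1}{a_{ii}-\sum_{j\ne i}|a_{ij}|p^{(t)}_{ji}}.$$ *)

theory Defs
  imports
    "HOL-Analysis.Analysis"
    "Jordan_Normal_Form.Spectral_Radius"
    "Jordan_Normal_Form.Gauss_Jordan_Elimination"
begin

text \<open>Matrices are \<open>n \<times> n\<close> with rows and columns indexed by \<open>{0..<n}\<close>. On matrices,
  \<open>\<le>\<close> is the entrywise order.\<close>

definition nonsingular_M_matrices :: "nat \<Rightarrow> real mat set" where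
  "nonsingular_M_matrices n = {A \<in> carrier_mat n n.
     (\<forall>i<n. \<forall>j<n. i \<noteq> j \<longrightarrow> A $$ (i,j) \<le> 0) \<and>
     invertible_mat A \<and> 0\<^sub>m n n \<le> the (mat_inverse A)}"

text \<open>The spectral radius of a real matrix is that of the matrix regarded as complex.\<close>

definition tau :: "real mat \<Rightarrow> real" where
  "tau A = inverse (spectral_radius (map_mat complex_of_real (the (mat_inverse A))))"

definition strictly_diagonally_dominant :: "real mat \<Rightarrow> bool" where
  "strictly_diagonally_dominant A \<longleftrightarrow> square_mat A \<and>
     (\<forall>i<dim_row A. (\<Sum>j\<in>{0..<dim_row A} - {i}. \<bar>A $$ (i,j)\<bar>) < \<bar>A $$ (i,i)\<bar>)"

definition r_coef :: "real mat \<Rightarrow> nat \<Rightarrow> real" where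
  "r_coef A i = (MAX j\<in>{0..<dim_row A} - {i}.
     \<bar>A $$ (j,i)\<bar> / (\<bar>A $$ (j,j)\<bar> - (\<Sum>k\<in>{0..<dim_row A} - {j,i}. \<bar>A $$ (j,k)\<bar>)))"

definition m_coef :: "real mat \<Rightarrow> nat \<Rightarrow> nat \<Rightarrow> real" where
  "m_coef A j i =
     (\<bar>A $$ (j,i)\<bar> + (\<Sum>k\<in>{0..<dim_row A} - {j,i}. \<bar>A $$ (j,k)\<bar> * r_coef A i)) / \<bar>A $$ (j,j)\<bar>"

text \<open>The constants \<open>h\<^sub>i\<close> and \<open>h\<^sub>i\<^sup>(\<^sup>t\<^sup>)\<close> are given by one and the same expression, with \<open>w\<^sub>j\<^sub>i = m\<^sub>j\<^sub>i\<close>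
  and \<open>w\<^sub>j\<^sub>i = p\<^sub>j\<^sub>i\<^sup>(\<^sup>t\<^sup>)\<close> respectively; likewise \<open>u\<^sub>j\<^sub>i\<close> and \<open>u\<^sub>j\<^sub>i\<^sup>(\<^sup>t\<^sup>)\<close>.
  If \<open>A\<close> is strictly diagonally dominant, the denominators in \<open>h_coef\<close> for these \<open>w\<close> are at
  least \<open>\<bar>a\<^sub>j\<^sub>i\<bar>\<close>, so a denominator can vanish only in a quotient \<open>0 / 0\<close>, which counts as \<open>0\<close>.\<close>

definition h_coef :: "real mat \<Rightarrow> (nat \<Rightarrow> nat \<Rightarrow> real) \<Rightarrow> nat \<Rightarrow> real" where
  "h_coef A w i = (MAX j\<in>{0..<dim_row A} - {i}.
     \<bar>A $$ (j,i)\<bar> /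
       (\<bar>A $$ (j,j)\<bar> * w j i - (\<Sum>k\<in>{0..<dim_row A} - {j,i}. \<bar>A $$ (j,k)\<bar> * w k i)))"

definition u_coef :: "real mat \<Rightarrow> (nat \<Rightarrow> nat \<Rightarrow> real) \<Rightarrow> nat \<Rightarrow> nat \<Rightarrow> real" where
  "u_coef A w j i =
     (\<bar>A $$ (j,i)\<bar> + (\<Sum>k\<in>{0..<dim_row A} - {j,i}. \<bar>A $$ (j,k)\<bar> * w k i * h_coef A w i))
       / \<bar>A $$ (j,j)\<bar>"

definition p_coef :: "real mat \<Rightarrow> (nat \<Rightarrow> nat \<Rightarrow> real) \<Rightarrow> nat \<Rightarrow> nat \<Rightarrow> real" where
  "p_coef A u j i =
     (\<bar>A $$ (j,i)\<bar> + (\<Sum>k\<in>{0..<dim_row A} - {j,i}. \<bar>A $$ (j,k)\<bar> * u k i)) / \<bar>A $$ (j,j)\<bar>"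

primrec u_iter :: "real mat \<Rightarrow> nat \<Rightarrow> nat \<Rightarrow> nat \<Rightarrow> real" where
  "u_iter A 0 = u_coef A (m_coef A)"
| "u_iter A (Suc t) = u_coef A (p_coef A (u_iter A t))"

text \<open>Only meaningful for \<open>t \<ge> 1\<close>.\<close>

definition p_iter :: "real mat \<Rightarrow> nat \<Rightarrow> nat \<Rightarrow> nat \<Rightarrow> real" where
  "p_iter A t = p_coef A (u_iter A (t - 1))"

definition phi :: "real mat \<Rightarrow> nat \<Rightarrow> nat \<Rightarrow> real" where
  "phi A t i =
     1 / (A $$ (i,i) - (\<Sum>j\<in>{0..<dim_row A} - {i}. \<bar>A $$ (i,j)\<bar> * p_iter A t j i))"

definition phi_pair :: "real mat \<Rightarrow> nat \<Rightarrow> nat \<Rightarrow> nat \<Rightarrow> real" where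
  "phi_pair A t i j =
     max (phi A t i) (phi A t j) -
     min (1 / (A $$ (i,i) - (\<Sum>k\<in>{0..<dim_row A} - {i}. A $$ (i,k) * A $$ (k,i) / A $$ (k,k))))
         (1 / (A $$ (j,j) - (\<Sum>k\<in>{0..<dim_row A} - {j}. A $$ (j,k) * A $$ (k,j) / A $$ (k,k))))"

end

theory Submission
  imports Defs
begin

text \<open>Let \<open>B = A\<^sup>-\<^sup>1\<close>, so that \<open>\<tau>(A) = 1 / \<rho>(B)\<close>, and the task is to bound the modulus of an arbitrary
  eigenvalue of the nonnegative matrix \<open>B\<close> from above. Brauer's theorem on ovals of Cassini, applied
  to the columns of \<open>B\<close>, puts each eigenvalue \<open>\<lambda>\<close> into some oval
  \<open>\<bar>\<lambda> - b\<^sub>i\<^sub>i\<bar> \<bar>\<lambda> - b\<^sub>j\<^sub>j\<bar> \<le> C\<^sub>i C\<^sub>j\<close>, where \<open>C\<^sub>i\<close> is the sum of the off-diagonal entries of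
  column \<open>i\<close> (\<open>brauer_cassini_columns\<close>). Estimates for \<open>B\<close> in terms of \<open>A\<close> then give the result.

  The off-diagonal entries of \<open>B\<close> are controlled as follows. By \<open>A B = 1\<close>, the ratios
  \<open>x\<^sub>j = b\<^sub>j\<^sub>i / b\<^sub>i\<^sub>i\<close> solve the linear system
  \<open>a\<^sub>j\<^sub>j x\<^sub>j = \<bar>a\<^sub>j\<^sub>i\<bar> + \<Sum>\<^sub>k \<bar>a\<^sub>j\<^sub>k\<bar> x\<^sub>k\<close>, with \<open>k\<close> different from \<open>j\<close> and \<open>i\<close>. Because of diagonal
  dominance this system obeys a minimum principle, so each supersolution \<open>w\<close> satisfies \<open>x \<le> w\<close>
  (\<open>inverse_entry_le_majorant\<close>). All the coefficients in the definition of \<open>p\<^sup>(\<^sup>t\<^sup>)\<close> arise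
  from the constant supersolution \<open>r\<^sub>i\<close> by two operations that produce supersolutions from
  supersolutions: a Jacobi step of the system (\<open>column_majorant_p_coef\<close>), and multiplication by the
  least nonnegative factor that keeps the inequalities true (\<open>column_majorant_h_coef\<close>). Therefore
  \<open>b\<^sub>j\<^sub>i \<le> p\<^sub>j\<^sub>i\<^sup>(\<^sup>t\<^sup>) b\<^sub>i\<^sub>i\<close>.

  Inserting this into the diagonal equation \<open>a\<^sub>i\<^sub>i b\<^sub>i\<^sub>i - \<Sum>\<^sub>k \<bar>a\<^sub>i\<^sub>k\<bar> b\<^sub>k\<^sub>i = 1\<close> gives
  \<open>b\<^sub>i\<^sub>i \<le> \<phi>\<^sub>i\<^sup>(\<^sup>t\<^sup>)\<close>, hence \<open>C\<^sub>i \<le> \<phi>\<^sub>i\<^sup>(\<^sup>t\<^sup>) \<Sum>\<^sub>k p\<^sub>k\<^sub>i\<^sup>(\<^sup>t\<^sup>)\<close>; inserting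
  \<open>b\<^sub>k\<^sub>i \<ge> \<bar>a\<^sub>k\<^sub>i\<bar> b\<^sub>i\<^sub>i / a\<^sub>k\<^sub>k\<close> instead gives the lower bound for \<open>b\<^sub>i\<^sub>i\<close> that occurs in
  \<open>\<phi>\<^sub>i\<^sub>j\<^sup>(\<^sup>t\<^sup>)\<close>. So \<open>\<phi>\<^sub>i\<^sub>j\<^sup>(\<^sup>t\<^sup>)\<close> dominates both \<open>\<bar>b\<^sub>i\<^sub>i - b\<^sub>j\<^sub>j\<bar>\<close> and
  \<open>\<bar>\<phi>\<^sub>i\<^sup>(\<^sup>t\<^sup>) - \<phi>\<^sub>j\<^sup>(\<^sup>t\<^sup>)\<bar>\<close>, and solving the quadratic inequality of the oval for \<open>\<bar>\<lambda>\<bar>\<close>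
  finishes the proof.\<close>

section \<open>Majorants of the columns of the inverse\<close>

text \<open>Supersolutions with values in \<open>[0, 1]\<close> of the system for the ratios \<open>b\<^sub>j\<^sub>i / b\<^sub>i\<^sub>i\<close>. The bound
  by \<open>1\<close> makes the denominator of \<open>phi\<close> positive.\<close>

definition column_majorant :: "real mat \<Rightarrow> nat \<Rightarrow> (nat \<Rightarrow> real) \<Rightarrow> bool" where
  "column_majorant A i w \<longleftrightarrow> (\<forall>j\<in>{0..<dim_row A} - {i}. 0 \<le> w j \<and> w j \<le> 1 \<and>
     \<bar>A $$ (j,i)\<bar> + (\<Sum>k\<in>{0..<dim_row A} - {j,i}. \<bar>A $$ (j,k)\<bar> * w k) \<le> \<bar>A $$ (j,j)\<bar> * w j)"

lemma column_majorantD: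
  assumes "column_majorant A i w" "j < dim_row A" "j \<noteq> i"
  shows "0 \<le> w j" "w j \<le> 1"
    "\<bar>A $$ (j,i)\<bar> + (\<Sum>k\<in>{0..<dim_row A} - {j,i}. \<bar>A $$ (j,k)\<bar> * w k) \<le> \<bar>A $$ (j,j)\<bar> * w j"
  using assms by (auto simp: column_majorant_def)

lemma sum_row_split:
  fixes f :: "nat \<Rightarrow> 'a::comm_monoid_add"
  assumes "i < n" "j \<noteq> i"
  shows "(\<Sum>k\<in>{0..<n} - {j}. f k) = f i + (\<Sum>k\<in>{0..<n} - {j,i}. f k)"
proof -
  have "{0..<n} - {j} - {i} = {0..<n} - {j,i}" by auto
  then show ?thesis using assms sum.remove[of "{0..<n} - {j}" i f] by auto
qed

lemma strictly_diagonally_dominant_row: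
  assumes "strictly_diagonally_dominant A" "i < dim_row A" "j < dim_row A" "j \<noteq> i"
  shows "\<bar>A $$ (j,i)\<bar> + (\<Sum>k\<in>{0..<dim_row A} - {j,i}. \<bar>A $$ (j,k)\<bar>) < \<bar>A $$ (j,j)\<bar>"
  using assms sum_row_split[of i "dim_row A" j "\<lambda>k. \<bar>A $$ (j,k)\<bar>"]
  by (auto simp: strictly_diagonally_dominant_def)

lemma strictly_diagonally_dominant_diag_nonzero:
  assumes "strictly_diagonally_dominant A" "j < dim_row A"
  shows "0 < \<bar>A $$ (j,j)\<bar>"
proof -
  have "0 \<le> (\<Sum>k\<in>{0..<dim_row A} - {j}. \<bar>A $$ (j,k)\<bar>)" by (simp add: sum_nonneg)
  also have "\<dots> < \<bar>A $$ (j,j)\<bar>" using assms by (auto simp: strictly_diagonally_dominant_def)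
  finally show ?thesis .
qed

lemma other_index_exists:
  assumes "2 \<le> (n::nat)"
  shows "{0..<n} - {i} \<noteq> {}"
proof -
  have "0 \<in> {0..<n} - {i} \<or> 1 \<in> {0..<n} - {i}" using assms by auto
  then show ?thesis by blast
qed

text \<open>For a constant \<open>r\<close> the supersolution inequality at \<open>j\<close> says that \<open>r\<close> is at least the quotient
  with index \<open>j\<close> in the definition of \<open>r\<^sub>i\<close>, so \<open>r\<^sub>i\<close> is the least constant supersolution; diagonal
  dominance at each \<open>j\<close> is what makes it less than \<open>1\<close>.\<close>

lemma column_majorant_r_coef:
  assumes sdd: "strictly_diagonally_dominant A" and n: "2 \<le> dim_row A" and i: "i < dim_row A"
  shows "column_majorant A i (\<lambda>_. r_coef A i)"
proof -
  let ?I = "{0..<dim_row A} - {i}"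
  let ?D = "\<lambda>j. \<bar>A $$ (j,j)\<bar> - (\<Sum>k\<in>{0..<dim_row A} - {j,i}. \<bar>A $$ (j,k)\<bar>)"
  have D: "\<bar>A $$ (j,i)\<bar> < ?D j" if "j \<in> ?I" for j
    using strictly_diagonally_dominant_row[OF sdd i, of j] that by auto
  have ge: "\<bar>A $$ (j,i)\<bar> / ?D j \<le> r_coef A i" if "j \<in> ?I" for j
    unfolding r_coef_def using that by (intro Max_ge) auto
  have "r_coef A i \<in> (\<lambda>j. \<bar>A $$ (j,i)\<bar> / ?D j) ` ?I"
    unfolding r_coef_def using other_index_exists[OF n, of i] by (intro Max_in) auto
  then obtain j0 where j0: "j0 \<in> ?I" "r_coef A i = \<bar>A $$ (j0,i)\<bar> / ?D j0" by blast
  have "0 \<le> r_coef A i" "r_coef A i \<le> 1"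
    unfolding j0(2) using D[OF j0(1)] by (auto simp: divide_simps)
  moreover have "\<bar>A $$ (j,i)\<bar> + (\<Sum>k\<in>{0..<dim_row A} - {j,i}. \<bar>A $$ (j,k)\<bar> * r_coef A i)
      \<le> \<bar>A $$ (j,j)\<bar> * r_coef A i" if "j \<in> ?I" for j
  proof -
    have "0 < ?D j" using D[OF that] by linarith
    then have "\<bar>A $$ (j,i)\<bar> \<le> r_coef A i * ?D j" using ge[OF that] by (simp add: pos_divide_le_eq)
    then show ?thesis by (simp add: algebra_simps sum_distrib_left)
  qed
  ultimately show ?thesis by (auto simp: column_majorant_def)
qed

text \<open>\<open>p_coef\<close> is one Jacobi step. It turns the supersolution inequality into an equation with the old
  values on the right; since the step decreases a supersolution, replacing the old values by the new
  ones only lowers that side.\<close>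

lemma column_majorant_p_coef:
  assumes sdd: "strictly_diagonally_dominant A" and w: "column_majorant A i (\<lambda>k. w k i)"
  shows "column_majorant A i (\<lambda>k. p_coef A w k i)"
proof -
  have le: "p_coef A w j i \<le> w j i" and ge: "0 \<le> p_coef A w j i"
    and eq: "\<bar>A $$ (j,j)\<bar> * p_coef A w j i
      = \<bar>A $$ (j,i)\<bar> + (\<Sum>k\<in>{0..<dim_row A} - {j,i}. \<bar>A $$ (j,k)\<bar> * w k i)"
    if "j < dim_row A" "j \<noteq> i" for j
  proof -
    have pos: "0 < \<bar>A $$ (j,j)\<bar>" by (rule strictly_diagonally_dominant_diag_nonzero[OF sdd that(1)])
    show "p_coef A w j i \<le> w j i"
      using column_majorantD(3)[OF w that] pos
      by (simp add: p_coef_def pos_divide_le_eq mult.commute)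
    show "0 \<le> p_coef A w j i"
      unfolding p_coef_def using column_majorantD(1)[OF w]
      by (intro divide_nonneg_nonneg add_nonneg_nonneg sum_nonneg) auto
    show "\<bar>A $$ (j,j)\<bar> * p_coef A w j i
      = \<bar>A $$ (j,i)\<bar> + (\<Sum>k\<in>{0..<dim_row A} - {j,i}. \<bar>A $$ (j,k)\<bar> * w k i)"
      using pos by (simp add: p_coef_def)
  qed
  have "(\<Sum>k\<in>{0..<dim_row A} - {j,i}. \<bar>A $$ (j,k)\<bar> * p_coef A w k i)
      \<le> (\<Sum>k\<in>{0..<dim_row A} - {j,i}. \<bar>A $$ (j,k)\<bar> * w k i)" for j
    by (intro sum_mono mult_left_mono le) auto
  then show ?thesis
    unfolding column_majorant_def using ge eq
    by (auto intro: order_trans[OF le column_majorantD(2)[OF w]])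
qed

text \<open>Being a supersolution means that the denominators in \<open>h_coef\<close> are at least the numerators, whence
  the factor lies in \<open>[0, 1]\<close>; and it is chosen so that the scaled inequalities still hold.\<close>

lemma column_majorant_h_coef:
  assumes n: "2 \<le> dim_row A" and w: "column_majorant A i (\<lambda>k. w k i)"
  shows "column_majorant A i (\<lambda>k. w k i * h_coef A w i)"
proof -
  let ?I = "{0..<dim_row A} - {i}"
  let ?D = "\<lambda>j. \<bar>A $$ (j,j)\<bar> * w j i - (\<Sum>k\<in>{0..<dim_row A} - {j,i}. \<bar>A $$ (j,k)\<bar> * w k i)"
  have D: "\<bar>A $$ (j,i)\<bar> \<le> ?D j" if "j \<in> ?I" for j
    using column_majorantD(3)[OF w, of j] that by auto
  have ge: "\<bar>A $$ (j,i)\<bar> / ?D j \<le> h_coef A w i" if "j \<in> ?I" for j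
    unfolding h_coef_def using that by (intro Max_ge) auto
  have "h_coef A w i \<in> (\<lambda>j. \<bar>A $$ (j,i)\<bar> / ?D j) ` ?I"
    unfolding h_coef_def using other_index_exists[OF n, of i] by (intro Max_in) auto
  then obtain j0 where j0: "j0 \<in> ?I" "h_coef A w i = \<bar>A $$ (j0,i)\<bar> / ?D j0" by blast
  have h: "0 \<le> h_coef A w i" "h_coef A w i \<le> 1"
    unfolding j0(2) using D[OF j0(1)] by (auto simp: divide_simps)
  have "\<bar>A $$ (j,i)\<bar> + (\<Sum>k\<in>{0..<dim_row A} - {j,i}. \<bar>A $$ (j,k)\<bar> * (w k i * h_coef A w i))
      \<le> \<bar>A $$ (j,j)\<bar> * (w j i * h_coef A w i)" if "j \<in> ?I" for j
  proof -
    \<comment> \<open>If the denominator vanishes, so does the numerator.\<close>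
    have "\<bar>A $$ (j,i)\<bar> \<le> h_coef A w i * ?D j"
    proof (cases "?D j = 0")
      case True
      then show ?thesis using D[OF that] by simp
    next
      case False
      then have "0 < ?D j" using D[OF that] by linarith
      then show ?thesis using ge[OF that] by (simp add: pos_divide_le_eq)
    qed
    then show ?thesis by (simp add: algebra_simps sum_distrib_left)
  qed
  then show ?thesis
    unfolding column_majorant_def using h column_majorantD(1,2)[OF w]
    by (auto intro: mult_le_one)
qed

text \<open>The coefficients \<open>m\<close> and \<open>u\<close> are Jacobi steps too, starting from \<open>r\<close> and from a
  supersolution rescaled by \<open>h\<close>.\<close>

lemma m_coef_eq_p_coef: "m_coef A = p_coef A (\<lambda>k i. r_coef A i)"
  by (intro ext) (simp add: m_coef_def p_coef_def)

lemma u_coef_eq_p_coef: "u_coef A w = p_coef A (\<lambda>k i. w k i * h_coef A w i)"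
  by (intro ext) (simp add: u_coef_def p_coef_def mult.assoc)

lemma column_majorant_u_iter:
  assumes sdd: "strictly_diagonally_dominant A" and n: "2 \<le> dim_row A" and i: "i < dim_row A"
  shows "column_majorant A i (\<lambda>k. u_iter A t k i)"
proof (induction t)
  case 0
  have "column_majorant A i (\<lambda>k. m_coef A k i)"
    unfolding m_coef_eq_p_coef
    by (intro column_majorant_p_coef column_majorant_r_coef sdd n i)
  then show ?case
    by (simp add: u_coef_eq_p_coef column_majorant_p_coef column_majorant_h_coef sdd n)
next
  case (Suc t)
  then show ?case
    by (simp add: u_coef_eq_p_coef column_majorant_p_coef column_majorant_h_coef sdd n)
qed

lemma column_majorant_p_iter:
  assumes "strictly_diagonally_dominant A" "2 \<le> dim_row A" "i < dim_row A"
  shows "column_majorant A i (\<lambda>k. p_iter A t k i)"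
  using assms by (simp add: p_iter_def column_majorant_p_coef column_majorant_u_iter)


section \<open>Entries of the inverse\<close>

text \<open>Invertibility in the sense of \<open>invertible_mat\<close> leaves the shape of the inverse open; comparing
  dimensions in both products shows that it is square, so that Gauss--Jordan elimination finds it.\<close>

lemma nonsingular_M_matrix_inverse:
  assumes A: "A \<in> nonsingular_M_matrices n"
  obtains B where "the (mat_inverse A) = B" "B \<in> carrier_mat n n" "A * B = 1\<^sub>m n"
    "\<And>i j. i < n \<Longrightarrow> j < n \<Longrightarrow> 0 \<le> B $$ (i,j)"
proof -
  have carr: "A \<in> carrier_mat n n" and inv: "invertible_mat A"
    and nn: "0\<^sub>m n n \<le> the (mat_inverse A)"
    using A by (auto simp: nonsingular_M_matrices_def)
  obtain C where C: "A * C = 1\<^sub>m n" "C * A = 1\<^sub>m (dim_row C)"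
    using inv carr unfolding invertible_mat_def inverts_mat_def by auto
  have "dim_col C = n" using arg_cong[OF C(1), of dim_col] by simp
  moreover have "dim_row C = n" using arg_cong[OF C(2), of dim_col] carr by simp
  ultimately have "C \<in> carrier_mat n n" by blast
  then have "A \<in> Units (ring_mat TYPE(real) n ())"
    using C carr \<open>dim_row C = n\<close> by (auto simp: Units_def ring_mat_def)
  then obtain B where B: "mat_inverse A = Some B"
    using mat_inverse(1)[OF carr, of "()"] by (cases "mat_inverse A") auto
  have "0 \<le> B $$ (i,j)" if "i < n" "j < n" for i j
    using nn that B by (auto simp: less_eq_mat_def)
  then show ?thesis using that[of B] B mat_inverse(2)[OF carr B] by auto
qed

locale sdd_M_matrix =
  fixes A B :: "real mat" and n :: nat
  assumes carrier [simp]: "A \<in> carrier_mat n n" "B \<in> carrier_mat n n"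
    and off_diag: "\<And>i j. i < n \<Longrightarrow> j < n \<Longrightarrow> i \<noteq> j \<Longrightarrow> A $$ (i,j) \<le> 0"
    and right_inverse: "A * B = 1\<^sub>m n"
    and inverse_nonneg: "\<And>i j. i < n \<Longrightarrow> j < n \<Longrightarrow> 0 \<le> B $$ (i,j)"
    and sdd: "strictly_diagonally_dominant A"
begin

lemma dims [simp]: "dim_row A = n" "dim_col A = n" "dim_row B = n" "dim_col B = n"
  using carrier_matD[OF carrier(1)] carrier_matD[OF carrier(2)] by auto

text \<open>The entry \<open>(j, i)\<close> of \<open>A B = 1\<close>, arranged so that both sides consist of nonnegative terms.\<close>

lemma row_times_column:
  assumes "j < n" "i < n"
  shows "A $$ (j,j) * B $$ (j,i) =
    (if j = i then 1 else 0) + (\<Sum>k\<in>{0..<n} - {j}. \<bar>A $$ (j,k)\<bar> * B $$ (k,i))"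
proof -
  have "(if j = i then 1 else 0) = (A * B) $$ (j,i)"
    using assms by (simp add: right_inverse)
  also have "\<dots> = (\<Sum>k\<in>{0..<n}. A $$ (j,k) * B $$ (k,i))"
    using assms by (simp add: scalar_prod_def)
  also have "\<dots> = A $$ (j,j) * B $$ (j,i) + (\<Sum>k\<in>{0..<n} - {j}. A $$ (j,k) * B $$ (k,i))"
    using assms by (intro sum.remove) auto
  also have "(\<Sum>k\<in>{0..<n} - {j}. A $$ (j,k) * B $$ (k,i))
      = - (\<Sum>k\<in>{0..<n} - {j}. \<bar>A $$ (j,k)\<bar> * B $$ (k,i))"
    unfolding sum_negf[symmetric] using off_diag[of j] assms by (intro sum.cong) auto
  finally show ?thesis by linarith
qed

lemma diag_pos:
  assumes "i < n"
  shows "0 < A $$ (i,i)" "0 < B $$ (i,i)"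
proof -
  have "0 \<le> (\<Sum>k\<in>{0..<n} - {i}. \<bar>A $$ (i,k)\<bar> * B $$ (k,i))"
    using inverse_nonneg assms by (intro sum_nonneg) auto
  then have "0 < A $$ (i,i) * B $$ (i,i)" using row_times_column[OF assms assms] by simp
  then show "0 < A $$ (i,i)" "0 < B $$ (i,i)"
    using inverse_nonneg[OF assms assms] by (auto simp: zero_less_mult_iff)
qed

lemma row_times_column_off_diag:
  assumes "j < n" "i < n" "j \<noteq> i"
  shows "A $$ (j,j) * B $$ (j,i) = \<bar>A $$ (j,i)\<bar> * B $$ (i,i)
    + (\<Sum>k\<in>{0..<n} - {j,i}. \<bar>A $$ (j,k)\<bar> * B $$ (k,i))"
  using row_times_column[OF assms(1,2)] assms
    sum_row_split[of i n j "\<lambda>k. \<bar>A $$ (j,k)\<bar> * B $$ (k,i)"] by simp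

text \<open>The minimum principle. Let \<open>d\<^sub>j = w\<^sub>j b\<^sub>i\<^sub>i - b\<^sub>j\<^sub>i\<close>; subtracting the equation for column \<open>i\<close> of
  \<open>B\<close> from the inequality for \<open>w\<close> gives \<open>a\<^sub>j\<^sub>j d\<^sub>j \<ge> \<Sum>\<^sub>k \<bar>a\<^sub>j\<^sub>k\<bar> d\<^sub>k\<close>. At an index \<open>q\<close> where \<open>d\<close> is
  least, the right side is at least \<open>(\<Sum>\<^sub>k \<bar>a\<^sub>q\<^sub>k\<bar>) d\<^sub>q\<close>, and diagonal dominance forces \<open>d\<^sub>q \<ge> 0\<close>.\<close>

lemma inverse_entry_le_majorant:
  assumes w: "column_majorant A i w" and i: "i < n" and j: "j < n" "j \<noteq> i"
  shows "B $$ (j,i) \<le> w j * B $$ (i,i)"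
proof -
  let ?I = "{0..<n} - {i}"
  let ?d = "\<lambda>j. w j * B $$ (i,i) - B $$ (j,i)"
  have "Min (?d ` ?I) \<in> ?d ` ?I" using j by (intro Min_in) auto
  then obtain q where "q \<in> ?I" and qmin: "Min (?d ` ?I) = ?d q" by (rule imageE)
  then have q: "q < n" "q \<noteq> i" by auto
  have min: "?d q \<le> ?d k" if "k < n" "k \<noteq> i" for k
    unfolding qmin[symmetric] using that by (intro Min_le) auto
  let ?s = "\<Sum>k\<in>{0..<n} - {q,i}. \<bar>A $$ (q,k)\<bar>"
  have "?s * ?d q \<le> (\<Sum>k\<in>{0..<n} - {q,i}. \<bar>A $$ (q,k)\<bar> * ?d k)"
    unfolding sum_distrib_right by (intro sum_mono mult_left_mono min) auto
  also have "\<dots> = (\<Sum>k\<in>{0..<n} - {q,i}. \<bar>A $$ (q,k)\<bar> * w k) * B $$ (i,i)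
      - (\<Sum>k\<in>{0..<n} - {q,i}. \<bar>A $$ (q,k)\<bar> * B $$ (k,i))"
    by (simp add: algebra_simps sum_subtractf sum_distrib_left sum_distrib_right)
  also have "\<dots> \<le> (A $$ (q,q) * w q - \<bar>A $$ (q,i)\<bar>) * B $$ (i,i)
      - (\<Sum>k\<in>{0..<n} - {q,i}. \<bar>A $$ (q,k)\<bar> * B $$ (k,i))"
    using column_majorantD(3)[OF w, of q] q diag_pos[OF q(1)] inverse_nonneg[OF i i]
    by (intro diff_mono mult_right_mono) auto
  also have "\<dots> = A $$ (q,q) * ?d q"
    using row_times_column_off_diag[OF q(1) i q(2)] by (simp add: algebra_simps)
  finally have "0 \<le> (A $$ (q,q) - ?s) * ?d q" by (simp add: algebra_simps)
  moreover have "0 < A $$ (q,q) - ?s"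
    using strictly_diagonally_dominant_row[OF sdd, of i q] q i diag_pos[OF q(1)] by simp
  ultimately have "0 \<le> ?d q" by (simp add: zero_le_mult_iff)
  then show ?thesis using min[OF j] by linarith
qed

lemma inverse_diag_le:
  assumes w: "column_majorant A i w" and i: "i < n"
  shows "B $$ (i,i) \<le> 1 / (A $$ (i,i) - (\<Sum>j\<in>{0..<n} - {i}. \<bar>A $$ (i,j)\<bar> * w j))"
proof -
  let ?s = "\<Sum>j\<in>{0..<n} - {i}. \<bar>A $$ (i,j)\<bar> * w j"
  have "?s \<le> (\<Sum>j\<in>{0..<n} - {i}. \<bar>A $$ (i,j)\<bar>)"
    using column_majorantD(2)[OF w] by (intro sum_mono mult_left_le) auto
  also have "\<dots> < A $$ (i,i)"
    using sdd i diag_pos[OF i] by (auto simp: strictly_diagonally_dominant_def)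
  finally have pos: "0 < A $$ (i,i) - ?s" by simp
  have "(\<Sum>k\<in>{0..<n} - {i}. \<bar>A $$ (i,k)\<bar> * B $$ (k,i))
      \<le> (\<Sum>k\<in>{0..<n} - {i}. \<bar>A $$ (i,k)\<bar> * (w k * B $$ (i,i)))"
    using i by (intro sum_mono mult_left_mono inverse_entry_le_majorant[OF w]) auto
  then have "B $$ (i,i) * (A $$ (i,i) - ?s) \<le> 1"
    using row_times_column[OF i i] by (simp add: algebra_simps sum_distrib_left)
  then show ?thesis using pos by (simp add: pos_le_divide_eq)
qed

text \<open>Dropping all but the first term on the right of \<open>row_times_column_off_diag\<close> gives
  \<open>b\<^sub>k\<^sub>i \<ge> \<bar>a\<^sub>k\<^sub>i\<bar> b\<^sub>i\<^sub>i / a\<^sub>k\<^sub>k\<close>. The diagonal equation then shows both that the denominator is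
  positive and that the bound holds.\<close>

lemma inverse_diag_ge:
  assumes i: "i < n"
  shows "1 / (A $$ (i,i) - (\<Sum>k\<in>{0..<n} - {i}. A $$ (i,k) * A $$ (k,i) / A $$ (k,k)))
    \<le> B $$ (i,i)"
proof -
  let ?s = "\<Sum>k\<in>{0..<n} - {i}. A $$ (i,k) * A $$ (k,i) / A $$ (k,k)"
  have "A $$ (i,k) * A $$ (k,i) / A $$ (k,k) * B $$ (i,i) \<le> \<bar>A $$ (i,k)\<bar> * B $$ (k,i)"
    if k: "k < n" "k \<noteq> i" for k
  proof -
    have "0 \<le> (\<Sum>l\<in>{0..<n} - {k,i}. \<bar>A $$ (k,l)\<bar> * B $$ (l,i))"
      using inverse_nonneg i by (intro sum_nonneg) auto
    then have "\<bar>A $$ (k,i)\<bar> / A $$ (k,k) * B $$ (i,i) \<le> B $$ (k,i)"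
      using row_times_column_off_diag[OF k(1) i k(2)] diag_pos[OF k(1)] by (simp add: field_simps)
    then have "\<bar>A $$ (i,k)\<bar> * (\<bar>A $$ (k,i)\<bar> / A $$ (k,k) * B $$ (i,i))
        \<le> \<bar>A $$ (i,k)\<bar> * B $$ (k,i)"
      by (intro mult_left_mono) auto
    then show ?thesis using off_diag[of i k] off_diag[of k i] i k by simp
  qed
  then have "?s * B $$ (i,i) \<le> (\<Sum>k\<in>{0..<n} - {i}. \<bar>A $$ (i,k)\<bar> * B $$ (k,i))"
    unfolding sum_distrib_right by (intro sum_mono) auto
  then have ge1: "1 \<le> B $$ (i,i) * (A $$ (i,i) - ?s)"
    using row_times_column[OF i i] by (simp add: algebra_simps)
  then have "0 < A $$ (i,i) - ?s"
    using diag_pos(2)[OF i] by (smt (verit) mult_nonneg_nonpos)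
  then show ?thesis using ge1 by (simp add: pos_divide_le_eq)
qed

end


section \<open>Brauer's ovals of Cassini\<close>

text \<open>Brauer's theorem for columns. Take a left eigenvector \<open>v\<close>, an index \<open>p\<close> where \<open>\<bar>v\<bar>\<close> is largest and an
  index \<open>q\<close> where it is largest among the others. Row \<open>p\<close> of the eigenvalue equation, in which only
  entries of size at most \<open>\<bar>v\<^sub>q\<bar>\<close> stand on the other side, and row \<open>q\<close>, in which they have size at most
  \<open>\<bar>v\<^sub>p\<bar>\<close>, are multiplied with each other, and \<open>\<bar>v\<^sub>p\<bar> \<bar>v\<^sub>q\<bar>\<close> cancels.\<close>

lemma brauer_cassini_columns:
  fixes C :: "complex mat"
  assumes C: "C \<in> carrier_mat n n" and n: "2 \<le> n" and ev: "eigenvalue C l"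
  obtains p q where "p < n" "q < n" "p \<noteq> q"
    "cmod (l - C $$ (p,p)) * cmod (l - C $$ (q,q))
      \<le> (\<Sum>k\<in>{0..<n} - {p}. cmod (C $$ (k,p))) * (\<Sum>k\<in>{0..<n} - {q}. cmod (C $$ (k,q)))"
proof -
  have "eigenvalue (transpose_mat C) l"
    using ev C by (simp add: eigenvalue_root_char_poly[of _ n] char_poly_transpose_mat)
  then obtain v where v: "v \<in> carrier_vec n" "v \<noteq> 0\<^sub>v n" "transpose_mat C *\<^sub>v v = l \<cdot>\<^sub>v v"
    using C unfolding eigenvalue_def eigenvector_def by auto
  define R where "R i = (\<Sum>k\<in>{0..<n} - {i}. cmod (C $$ (k,i)))" for i
  have R: "0 \<le> R i" for i unfolding R_def by (simp add: sum_nonneg)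
  have row: "cmod (l - C $$ (i,i)) * cmod (v $ i) \<le> R i * b"
    if i: "i < n" and b: "\<And>k. k < n \<Longrightarrow> k \<noteq> i \<Longrightarrow> cmod (v $ k) \<le> b" for i b
  proof -
    have "l * v $ i = (transpose_mat C *\<^sub>v v) $ i" using v i by simp
    also have "\<dots> = (\<Sum>k\<in>{0..<n}. C $$ (k,i) * v $ k)"
      using v(1) C i by (simp add: scalar_prod_def)
    also have "\<dots> = C $$ (i,i) * v $ i + (\<Sum>k\<in>{0..<n} - {i}. C $$ (k,i) * v $ k)"
      using i by (intro sum.remove) auto
    finally have "(l - C $$ (i,i)) * v $ i = (\<Sum>k\<in>{0..<n} - {i}. C $$ (k,i) * v $ k)"
      by (simp add: algebra_simps)
    then have "cmod (l - C $$ (i,i)) * cmod (v $ i)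
        = cmod (\<Sum>k\<in>{0..<n} - {i}. C $$ (k,i) * v $ k)"
      by (metis norm_mult)
    also have "\<dots> \<le> (\<Sum>k\<in>{0..<n} - {i}. cmod (C $$ (k,i)) * b)"
      using b by (intro sum_norm_le) (auto simp: norm_mult intro!: mult_left_mono)
    finally show ?thesis by (simp add: R_def sum_distrib_right)
  qed
  let ?N = "\<lambda>i. cmod (v $ i)"
  have "Max (?N ` {0..<n}) \<in> ?N ` {0..<n}" using n by (intro Max_in) auto
  then obtain p where p: "p < n" and pmax: "Max (?N ` {0..<n}) = ?N p" by auto
  have pge: "?N k \<le> ?N p" if "k < n" for k
    unfolding pmax[symmetric] using that by (intro Max_ge) auto
  have "Max (?N ` ({0..<n} - {p})) \<in> ?N ` ({0..<n} - {p})"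
    using other_index_exists[OF n, of p] by (intro Max_in) auto
  then obtain q where "q \<in> {0..<n} - {p}" and qmax: "Max (?N ` ({0..<n} - {p})) = ?N q"
    by (rule imageE)
  then have q: "q < n" "q \<noteq> p" by auto
  have qge: "?N k \<le> ?N q" if "k < n" "k \<noteq> p" for k
    unfolding qmax[symmetric] using that by (intro Max_ge) auto
  have "0 < ?N p"
  proof (rule ccontr)
    assume "\<not> 0 < ?N p"
    then have "v $ k = 0" if "k < n" for k using pge[OF that] by simp
    then show False using v(1,2) by (metis eq_vecI carrier_vecD index_zero_vec)
  qed
  have rp: "cmod (l - C $$ (p,p)) * ?N p \<le> R p * ?N q" by (rule row[OF p qge])
  have rq: "cmod (l - C $$ (q,q)) * ?N q \<le> R q * ?N p" by (rule row[OF q(1) pge])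
  have "cmod (l - C $$ (p,p)) * cmod (l - C $$ (q,q)) \<le> R p * R q"
  proof (cases "?N q = 0")
    case True
    \<comment> \<open>The vector \<open>v\<close> is then a multiple of a unit vector and \<open>l\<close> is a diagonal entry.\<close>
    then have "cmod (l - C $$ (p,p)) \<le> 0"
      using rp \<open>0 < ?N p\<close> by (simp add: mult_le_0_iff)
    then show ?thesis using R by simp
  next
    case False
    then have "0 < ?N p * ?N q" using \<open>0 < ?N p\<close> by simp
    moreover have "(cmod (l - C $$ (p,p)) * ?N p) * (cmod (l - C $$ (q,q)) * ?N q)
        \<le> (R p * ?N q) * (R q * ?N p)"
      using R by (intro mult_mono rp rq) auto
    then have "(cmod (l - C $$ (p,p)) * cmod (l - C $$ (q,q))) * (?N p * ?N q)
        \<le> (R p * R q) * (?N p * ?N q)"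
      by (simp only: mult_ac)
    ultimately show ?thesis by (rule mult_right_le_imp_le[rotated])
  qed
  then show ?thesis using that[OF p q(1)] q(2) unfolding R_def by blast
qed

text \<open>The right side is twice the larger root of \<open>(x - a) (x - b) = c\<close>.\<close>

lemma quadratic_root_bound:
  fixes x a b c :: real
  assumes "(x - a) * (x - b) \<le> c"
  shows "2 * x \<le> a + b + sqrt ((a - b)\<^sup>2 + 4 * c)"
proof -
  have "(2 * x - a - b)\<^sup>2 = (a - b)\<^sup>2 + 4 * ((x - a) * (x - b))"
    by (simp add: power2_eq_square algebra_simps)
  then have "2 * x - a - b \<le> sqrt ((a - b)\<^sup>2 + 4 * c)"
    using assms by (intro real_le_rsqrt) simp
  then show ?thesis by simp
qed

text \<open>If \<open>\<bar>z\<bar>\<close> exceeds both foci, then \<open>\<bar>z - a\<bar> \<ge> \<bar>z\<bar> - a\<close> and likewise for \<open>b\<close> turn the oval into a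
  quadratic inequality for \<open>\<bar>z\<bar>\<close>. Otherwise \<open>\<bar>z\<bar> \<le> max f g\<close>, and the assumption
  \<open>\<bar>f - g\<bar> \<le> d\<close> makes the claimed bound at least twice that. This second case replaces an appeal to
  the Perron--Frobenius theorem, by which the spectral radius of a nonnegative matrix is at least
  each diagonal entry.\<close>

lemma cassini_oval_modulus_bound:
  fixes z :: complex and a b f g d e :: real
  assumes oval: "cmod (z - of_real a) * cmod (z - of_real b) \<le> e"
    and a: "0 \<le> a" "a \<le> f" and b: "0 \<le> b" "b \<le> g"
    and d: "\<bar>a - b\<bar> \<le> d" "\<bar>f - g\<bar> \<le> d"
  shows "2 * cmod z \<le> f + g + sqrt (d\<^sup>2 + 4 * e)"
proof -
  have e: "0 \<le> e" using oval by (meson norm_ge_zero mult_nonneg_nonneg order_trans)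
  show ?thesis
  proof (cases "a < cmod z \<and> b < cmod z")
    case True
    have "cmod z - a \<le> cmod (z - of_real a)" "cmod z - b \<le> cmod (z - of_real b)"
      using norm_triangle_ineq2[of z "of_real a"] norm_triangle_ineq2[of z "of_real b"] a b
      by (auto simp: norm_of_real)
    then have "(cmod z - a) * (cmod z - b) \<le> e"
      using True by (intro order_trans[OF mult_mono oval]) auto
    then have "2 * cmod z \<le> a + b + sqrt ((a - b)\<^sup>2 + 4 * e)" by (rule quadratic_root_bound)
    also have "(a - b)\<^sup>2 \<le> d\<^sup>2" using d(1) by (simp add: abs_le_square_iff[symmetric])
    then have "sqrt ((a - b)\<^sup>2 + 4 * e) \<le> sqrt (d\<^sup>2 + 4 * e)" by simp
    finally show ?thesis using a b by linarith
  next
    case False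
    have "d \<le> sqrt (d\<^sup>2 + 4 * e)" using e by (intro real_le_rsqrt) simp
    then show ?thesis using False a b d(2) by linarith
  qed
qed


section \<open>The lower bound for the minimum eigenvalue\<close>

context sdd_M_matrix
begin

text \<open>This excludes \<open>\<rho>(B) = 0\<close>, for which \<open>tau\<close> would be the default value \<open>inverse 0 = 0\<close>.\<close>

lemma eigenvalue_inverse_nonzero:
  assumes "eigenvalue (map_mat complex_of_real B) l"
  shows "l \<noteq> 0"
proof
  assume "l = 0"
  let ?A = "map_mat complex_of_real A" and ?B = "map_mat complex_of_real B"
  obtain v where v: "v \<in> carrier_vec n" "v \<noteq> 0\<^sub>v n" "?B *\<^sub>v v = 0 \<cdot>\<^sub>v v"
    using assms \<open>l = 0\<close> unfolding eigenvalue_def eigenvector_def by auto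
  have "?A * ?B = map_mat complex_of_real (A * B)"
    by (rule of_real_hom.mat_hom_mult[symmetric, of _ n n _ n]) auto
  also have "\<dots> = 1\<^sub>m n" by (simp add: right_inverse of_real_hom.mat_hom_one)
  finally have "v = (?A * ?B) *\<^sub>v v" using v(1) by simp
  also have "\<dots> = ?A *\<^sub>v (?B *\<^sub>v v)"
    using v(1) by (intro assoc_mult_mat_vec[of _ n n _ n]) auto
  also have "?B *\<^sub>v v = 0\<^sub>v n" using v by auto
  also have "?A *\<^sub>v 0\<^sub>v n = 0\<^sub>v n" by (intro eq_vecI) auto
  finally show False using v(2) by simp
qed

lemma inverse_diag_le_phi:
  assumes "2 \<le> n" "i < n"
  shows "B $$ (i,i) \<le> phi A t i"
  using inverse_diag_le[OF column_majorant_p_iter[OF sdd, of i t]] assms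
  by (simp add: phi_def)

lemma inverse_column_sum_le:
  assumes n: "2 \<le> n" and i: "i < n"
  shows "(\<Sum>k\<in>{0..<n} - {i}. B $$ (k,i)) \<le> phi A t i * (\<Sum>k\<in>{0..<n} - {i}. p_iter A t k i)"
proof -
  have w: "column_majorant A i (\<lambda>k. p_iter A t k i)"
    using column_majorant_p_iter[OF sdd, of i t] n i by simp
  have "(\<Sum>k\<in>{0..<n} - {i}. B $$ (k,i)) \<le> (\<Sum>k\<in>{0..<n} - {i}. p_iter A t k i * phi A t i)"
  proof (rule sum_mono)
    fix k assume k: "k \<in> {0..<n} - {i}"
    then have "B $$ (k,i) \<le> p_iter A t k i * B $$ (i,i)"
      using inverse_entry_le_majorant[OF w i, of k] by simp
    also have "\<dots> \<le> p_iter A t k i * phi A t i"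
      using column_majorantD(1)[OF w, of k] k inverse_diag_le_phi[OF n i]
      by (intro mult_left_mono) auto
    finally show "B $$ (k,i) \<le> p_iter A t k i * phi A t i" .
  qed
  then show ?thesis by (simp add: sum_distrib_left mult.commute)
qed

text \<open>The numbers \<open>b\<^sub>i\<^sub>i\<close>, \<open>b\<^sub>j\<^sub>j\<close>, \<open>\<phi>\<^sub>i\<close> and \<open>\<phi>\<^sub>j\<close> all lie between the minimum and the maximum whose
  difference is \<open>phi_pair\<close>.\<close>

lemma phi_pair_ge:
  assumes n: "2 \<le> n" and i: "i < n" and j: "j < n"
  shows "\<bar>B $$ (i,i) - B $$ (j,j)\<bar> \<le> phi_pair A t i j"
    and "\<bar>phi A t i - phi A t j\<bar> \<le> phi_pair A t i j"
  using inverse_diag_le_phi[OF n i, of t] inverse_diag_le_phi[OF n j, of t]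
    inverse_diag_ge[OF i] inverse_diag_ge[OF j]
  by (auto simp: phi_pair_def)

lemma eigenvalue_inverse_bound:
  assumes n: "2 \<le> n" and ev: "eigenvalue (map_mat complex_of_real B) l"
  obtains i j where "i < n" "j < n" "i \<noteq> j"
    "2 * cmod l \<le> phi A t i + phi A t j + sqrt ((phi_pair A t i j)\<^sup>2 +
       4 * phi A t i * phi A t j *
         (\<Sum>k\<in>{0..<n} - {i}. p_iter A t k i) * (\<Sum>k\<in>{0..<n} - {j}. p_iter A t k j))"
proof -
  let ?B = "map_mat complex_of_real B"
  let ?P = "\<lambda>i. \<Sum>k\<in>{0..<n} - {i}. p_iter A t k i"
  have "?B \<in> carrier_mat n n" by simp
  then obtain i j where ij: "i < n" "j < n" "i \<noteq> j" and
    oval: "cmod (l - ?B $$ (i,i)) * cmod (l - ?B $$ (j,j))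
      \<le> (\<Sum>k\<in>{0..<n} - {i}. cmod (?B $$ (k,i))) * (\<Sum>k\<in>{0..<n} - {j}. cmod (?B $$ (k,j)))"
    using brauer_cassini_columns[OF _ n ev] by blast
  have col: "(\<Sum>k\<in>{0..<n} - {i}. cmod (?B $$ (k,i))) = (\<Sum>k\<in>{0..<n} - {i}. B $$ (k,i))"
    if "i < n" for i
    using that inverse_nonneg by (intro sum.cong) auto
  have nonneg: "0 \<le> (\<Sum>k\<in>{0..<n} - {i}. B $$ (k,i))" if "i < n" for i
    using that inverse_nonneg by (intro sum_nonneg) auto
  have "cmod (l - of_real (B $$ (i,i))) * cmod (l - of_real (B $$ (j,j)))
      \<le> (\<Sum>k\<in>{0..<n} - {i}. B $$ (k,i)) * (\<Sum>k\<in>{0..<n} - {j}. B $$ (k,j))"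
    using oval ij by (simp add: col del: index_map_mat(1)) (simp add: index_map_mat(1))
  also have "\<dots> \<le> (phi A t i * ?P i) * (phi A t j * ?P j)"
    using order_trans[OF nonneg inverse_column_sum_le[OF n]] ij
    by (intro mult_mono inverse_column_sum_le n nonneg) auto
  finally have "2 * cmod l \<le> phi A t i + phi A t j
      + sqrt ((phi_pair A t i j)\<^sup>2 + 4 * ((phi A t i * ?P i) * (phi A t j * ?P j)))"
    using ij inverse_nonneg
    by (intro cassini_oval_modulus_bound[where a = "B $$ (i,i)" and b = "B $$ (j,j)"]
        inverse_diag_le_phi phi_pair_ge n) auto
  then show ?thesis using that[OF ij] by (simp add: mult_ac)
qed

end

theorem theorem5:
  fixes A :: "real mat" and n t :: nat
  assumes "n \<ge> 2"
    and "A \<in> nonsingular_M_matrices n"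
    and "strictly_diagonally_dominant A"
    and "t \<ge> 1"
  shows "tau A \<ge> 2 /
    Max {phi A t i + phi A t j +
           sqrt ((phi_pair A t i j)\<^sup>2 +
                 4 * phi A t i * phi A t j *
                   (\<Sum>k\<in>{0..<n} - {i}. p_iter A t k i) *
                   (\<Sum>k\<in>{0..<n} - {j}. p_iter A t k j))
         | i j. i \<in> {0..<n} \<and> j \<in> {0..<n} \<and> i \<noteq> j}"
proof -
  let ?f = "\<lambda>i j. phi A t i + phi A t j + sqrt ((phi_pair A t i j)\<^sup>2 +
    4 * phi A t i * phi A t j *
      (\<Sum>k\<in>{0..<n} - {i}. p_iter A t k i) * (\<Sum>k\<in>{0..<n} - {j}. p_iter A t k j))"
  let ?S = "{?f i j | i j. i \<in> {0..<n} \<and> j \<in> {0..<n} \<and> i \<noteq> j}"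
  obtain B where B: "the (mat_inverse A) = B" "B \<in> carrier_mat n n" "A * B = 1\<^sub>m n"
      "\<And>i j. i < n \<Longrightarrow> j < n \<Longrightarrow> 0 \<le> B $$ (i,j)"
    using nonsingular_M_matrix_inverse[OF assms(2)] by metis
  interpret sdd_M_matrix A B n
    using B assms(2,3) by unfold_locales (auto simp: nonsingular_M_matrices_def)
  let ?B = "map_mat complex_of_real B"
  obtain l where ev: "eigenvalue ?B l" and l: "spectral_radius ?B = cmod l"
    using spectral_radius_mem_max(1)[of ?B n] B(2) assms(1) by (auto simp: spectrum_def)
  obtain i j where ij: "i < n" "j < n" "i \<noteq> j" and le: "2 * cmod l \<le> ?f i j"
    using eigenvalue_inverse_bound[OF assms(1) ev, of t] by blast
  have "?S \<subseteq> (\<lambda>(i,j). ?f i j) ` ({0..<n} \<times> {0..<n})" by auto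
  then have "finite ?S" by (rule finite_subset) auto
  moreover have "?f i j \<in> ?S" using ij by auto
  ultimately have "?f i j \<le> Max ?S" by (rule Max_ge)
  then have "2 * cmod l \<le> Max ?S" using le by linarith
  moreover have "0 < 2 * cmod l" using eigenvalue_inverse_nonzero[OF ev] by simp
  ultimately have "2 / Max ?S \<le> 2 / (2 * cmod l)" by (intro frac_le) simp_all
  then have "2 / Max ?S \<le> 1 / cmod l" by simp
  then show ?thesis by (simp add: tau_def B(1) l inverse_eq_divide)
qed

end
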